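(* Let $q$ be an arbitrary prime power, let $n$ be a positive integer, and let $S \subseteq \mathbb{F}_q^n \setminus \{0\}$ be a set of points such that (1) $S$ is not contained in any affine hyperplane of $\mathbb{F}_q^n$, (2) $S$ meets every affine hyperplane of $\mathbb{F}_q^n$, (3) $|S| < q^{n-2}(q-1)$. Let $f:\mathbb{F}_q^n\to\mathbb{F}_q$ be the indicator function of $S$ (i.e. $f(x)=1$ if $x\in S$ and $f(x)=0$ otherwise). Then the code $\mathcal C_f$ is a minimal code that does not satisfy the Ashikhmin–Barg condition.
   Context: A hyperplane is an $(n-1)$-dimensional subspace of $\mathbb{F}_q^n$; an affine hyperplane is a coset of a hyperplane (so hyperplanes are also affine hyperplanes). For a function $f:\mathbb{F}_q^n\to\mathbb{F}_q$, $\mathcal C_f$ is the $\mathbb{F}_q$-subspace of $\mathbb{F}_q^{q^n-1}$ spanned by the vectors $c(u,v) = (u f(x) + v\cdot x)_{x\in \mathbb{F}_q^n\setminus\{0\}}$ for $u\in\mathbb{F}_q$, $v\in\mathbb{F}_q^n$, where $v\cdot x$ is the usual dot product. The support of a vector is the set of coordinates where it is nonzero. A linear code $\mathcal C$ is minimal if for all codewords $c,c'\in\mathcal C$, $\mathrm{supp}(c)\subseteq\mathrm{supp}(c')$ implies $c=\lambda c'$ for some $\lambda\in\mathbb{F}_q^\times$. A $q$-ary linear code satisfies the Ashikhmin–Barg condition if $w_{\max}/w_{\min} < q/(q-1)$, where $w_{\min}$ and $w_{\max}$ are the minimum and maximum Hamming weights of the nonzero codewords.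
   Formalization: In the definition of a minimal code the codeword c is required to be nonzero; read literally with c = 0 allowed, the zero word's empty support would prevent any nonzero code from being minimal. *)

theory Defs
  imports "HOL-Analysis.Analysis"
begin

definition hyperplane :: "('a::field ^ 'n) set \<Rightarrow> bool" where
  "hyperplane H \<longleftrightarrow> vec.subspace H \<and> vec.dim H + 1 = CARD('n)"

definition affine_hyperplane :: "('a::field ^ 'n) set \<Rightarrow> bool" where
  "affine_hyperplane A \<longleftrightarrow> (\<exists>H a. hyperplane H \<and> A = (\<lambda>h. a + h) ` H)"

definition dot :: "'a::field ^ 'n \<Rightarrow> 'a ^ 'n \<Rightarrow> 'a" where
  "dot v x = (\<Sum>i\<in>UNIV. v $ i * x $ i)"

(* The coordinates of the code are indexed by the nonzero vectors, so its ambient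
   space is 'a ^ ('a, 'n) nonzero_vec, of dimension q^n - 1. *)
typedef (overloaded) ('a, 'n) nonzero_vec = "{x :: 'a::zero_neq_one ^ 'n::finite. x \<noteq> 0}"
  morphisms vec_of Abs_nonzero_vec
proof -
  have "(\<chi> i. 1) \<noteq> (0 :: 'a ^ 'n)"
    by (simp add: vec_eq_iff)
  then show ?thesis by blast
qed

instance nonzero_vec :: ("{zero_neq_one, finite}", finite) finite
proof
  have "inj (vec_of :: ('a, 'b) nonzero_vec \<Rightarrow> 'a ^ 'b)"
    by (simp add: inj_def vec_of_inject)
  then show "finite (UNIV :: ('a, 'b) nonzero_vec set)"
    by (rule finite_imageD[rotated]) simp
qed

definition codeword :: "('a::{field,finite} ^ 'n \<Rightarrow> 'a) \<Rightarrow> 'a \<Rightarrow> 'a ^ 'n \<Rightarrow> 'a ^ ('a, 'n) nonzero_vec" where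
  "codeword f u v = (\<chi> p. u * f (vec_of p) + dot v (vec_of p))"

definition code_of :: "('a::{field,finite} ^ 'n \<Rightarrow> 'a) \<Rightarrow> ('a ^ ('a, 'n) nonzero_vec) set" where
  "code_of f = vec.span {codeword f u v | u v. True}"

definition supp :: "'a::zero ^ 'i \<Rightarrow> 'i set" where
  "supp c = {i. c $ i \<noteq> 0}"

definition hamming_weight :: "'a::zero ^ 'i \<Rightarrow> nat" where
  "hamming_weight c = card (supp c)"

(* The codeword c is required to be nonzero: the zero word has empty support but is
   not a nonzero multiple of any other word. Then c' is nonzero as well. *)
definition minimal_code :: "('a::field ^ 'i) set \<Rightarrow> bool" where
  "minimal_code C \<longleftrightarrow>
     (\<forall>c\<in>C. \<forall>c'\<in>C. c \<noteq> 0 \<longrightarrow> supp c \<subseteq> supp c' \<longrightarrow> (\<exists>l. l \<noteq> 0 \<and> c = l *s c'))"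

definition min_weight :: "('a::zero ^ 'i) set \<Rightarrow> nat" where
  "min_weight C = Min (hamming_weight ` (C - {0}))"

definition max_weight :: "('a::zero ^ 'i) set \<Rightarrow> nat" where
  "max_weight C = Max (hamming_weight ` (C - {0}))"

definition ashikhmin_barg :: "('a::{field,finite} ^ 'i) set \<Rightarrow> bool" where
  "ashikhmin_barg C \<longleftrightarrow>
     real (max_weight C) / real (min_weight C) < real CARD('a) / (real CARD('a) - 1)"

end

theory Submission
  imports Defs
begin

text \<open>If \<open>v\<close> is not a multiple of \<open>v'\<close>, then at least
  \<open>q\<^sup>n\<^sup>-\<^sup>2 (q - 1)\<close> vectors are orthogonal to \<open>v'\<close> but not to \<open>v\<close>, so by (3) some of them lies outside \<open>S\<close>.
  Such a point is a zero of \<open>c(u', v')\<close> but not of \<open>c(u, v)\<close>, whatever \<open>u\<close> and \<open>u'\<close> are, so an inclusion of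
  supports forces \<open>v\<close> to be a multiple of \<open>v'\<close>. That \<open>u\<close> is the same multiple of \<open>u'\<close> follows by looking at a point of \<open>S\<close>
  on a suitable affine hyperplane parallel to the kernel of \<open>v'\<close>, which exists by (2).
  The Ashikhmin-Barg condition fails because \<open>c(1, 0)\<close> has weight \<open>|S|\<close>, whereas \<open>c(0, v)\<close>
  has weight \<open>q\<^sup>n\<^sup>-\<^sup>1 (q - 1)\<close>.\<close>

section \<open>Linear forms given by the dot product\<close>

lemma dot_add_left: "dot (v + w) x = dot v x + dot w x"
  by (simp add: dot_def algebra_simps sum.distrib)

lemma dot_add_right: "dot v (x + y) = dot v x + dot v y"
  by (simp add: dot_def algebra_simps sum.distrib)

lemma dot_scale_left: "dot (l *s v) x = l * dot v x"
  by (simp add: dot_def sum_distrib_left mult.assoc)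

lemma dot_scale_right: "dot v (l *s x) = l * dot v x"
  by (simp add: dot_def sum_distrib_left algebra_simps)

lemma dot_zero_left [simp]: "dot 0 x = 0"
  by (simp add: dot_def)

lemma dot_zero_right [simp]: "dot v 0 = 0"
  by (simp add: dot_def)

lemma dot_diff_right: "dot v (x - y) = dot v x - dot v y"
  using dot_add_right[of v "x - y" y] by simp

lemma dot_axis: "dot v (axis i 1) = v $ i"
proof -
  have "dot v (axis i 1) = (\<Sum>j\<in>UNIV. if j = i then v $ j else 0)"
    unfolding dot_def by (rule sum.cong) (auto simp: axis_def)
  then show ?thesis by simp
qed

lemma exists_dot_eq_one:
  assumes "v \<noteq> 0"
  shows "\<exists>a. dot v a = 1"
proof -
  obtain i where "v $ i \<noteq> 0" using assms by (auto simp: vec_eq_iff)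
  then have "dot v (inverse (v $ i) *s axis i 1) = 1"
    by (simp add: dot_scale_right dot_axis)
  then show ?thesis ..
qed

text \<open>Otherwise the kernel of \<open>dot v'\<close> lies in that of \<open>dot v\<close>, and
  then the two forms are proportional.\<close>

lemma exists_orthogonal_to_one_only:
  fixes v v' :: "'a::field ^ 'n"
  assumes "\<And>l. v \<noteq> l *s v'"
  shows "\<exists>a. dot v' a = 0 \<and> dot v a = 1"
proof (rule ccontr)
  assume no_a: "\<not> ?thesis"
  have van: "dot v x = 0" if "dot v' x = 0" for x
  proof (rule ccontr)
    assume "dot v x \<noteq> 0"
    then have "dot v' (inverse (dot v x) *s x) = 0 \<and> dot v (inverse (dot v x) *s x) = 1"
      by (simp add: dot_scale_right that)
    then show False using no_a by blast
  qed
  show False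
  proof (cases "v' = 0")
    case True
    then have "v $ i = 0" for i using van[of "axis i 1"] by (simp add: dot_axis)
    then have "v = 0 *s v'" by (simp add: vec_eq_iff)
    then show ?thesis using assms by blast
  next
    case False
    then obtain i where i: "v' $ i \<noteq> 0" by (auto simp: vec_eq_iff)
    \<comment> \<open>The vector in \<open>van\<close> is orthogonal to \<open>v'\<close> by
      construction, and \<open>v' $ i\<close> can be divided out.\<close>
    have "v' $ i * v $ j = v' $ j * v $ i" for j
      using van[of "v' $ i *s axis j 1 - v' $ j *s axis i 1"]
      by (simp add: dot_diff_right dot_scale_right dot_axis)
    then have "v = (v $ i / v' $ i) *s v'"
      using i by (simp add: vec_eq_iff field_simps)
    then show ?thesis using assms by blast
  qed
qed

text \<open>Adding one vector \<open>a\<close> with \<open>dot v a = 1\<close> to the kernel of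
  \<open>dot v\<close> spans the whole space, so the kernel has codimension 1; the level
  \<open>s\<close> is its translate by \<open>s *s a\<close>. This turns (2) into a statement about
  values of linear forms on \<open>S\<close>.\<close>

lemma affine_hyperplane_dot_eq:
  fixes v :: "'a::field ^ 'n"
  assumes "v \<noteq> 0"
  shows "affine_hyperplane {x. dot v x = s}"
proof -
  define H where "H = {x. dot v x = 0}"
  obtain a where a: "dot v a = 1" using exists_dot_eq_one[OF assms] by blast
  have sub: "vec.subspace H"
    by (auto simp: vec.subspace_def H_def dot_add_right dot_scale_right)
  have "x \<in> vec.span (insert a H)" for x
  proof -
    have "x - dot v x *s a \<in> H"
      by (simp add: H_def dot_diff_right dot_scale_right a)
    then have "(x - dot v x *s a) + dot v x *s a \<in> vec.span (insert a H)"
      by (intro vec.span_add vec.span_scale vec.span_base) auto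
    then show ?thesis by simp
  qed
  then have "vec.span (insert a H) = UNIV" by blast
  then have "vec.dim (insert a H) = CARD('n)"
    using vec.dim_span[of "insert a H"] by (simp add: vec.dim_UNIV card_cart_basis)
  moreover have "a \<notin> vec.span H"
    using a sub by (simp add: vec.span_eq_iff[THEN iffD2] H_def)
  ultimately have "hyperplane H"
    using sub by (simp add: hyperplane_def vec.dim_insert)
  moreover have "{x. dot v x = s} = (\<lambda>h. s *s a + h) ` H"
  proof (intro equalityI subsetI)
    fix x assume "x \<in> {x. dot v x = s}"
    then have "x - s *s a \<in> H" by (simp add: H_def dot_diff_right dot_scale_right a)
    then show "x \<in> (\<lambda>h. s *s a + h) ` H" by (rule rev_image_eqI) simp
  qed (auto simp: H_def dot_add_right dot_scale_right a)
  ultimately show ?thesis unfolding affine_hyperplane_def by blast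
qed

section \<open>Counting solutions of linear conditions\<close>

text \<open>All fibres are translates of the kernel, hence equally large. The product form avoids
  division of natural numbers.\<close>

lemma card_vimage_additive_surj:
  fixes g :: "'b::{ab_group_add,finite} \<Rightarrow> 'c::{ab_group_add,finite}"
  assumes add: "\<And>x y. g (x + y) = g x + g y" and surj: "surj g"
  shows "card (g -` B) * CARD('c) = card B * CARD('b)"
proof -
  have fibre: "card (g -` {y}) = card (g -` {0})" for y
  proof -
    obtain a where a: "g a = y" using surj by (metis surjD)
    have g0: "g x = 0 \<longleftrightarrow> g (a + x) = y" for x by (simp add: add a)
    have "g -` {y} = (\<lambda>x. a + x) ` (g -` {0})"
    proof (intro equalityI subsetI)
      fix x assume "x \<in> g -` {y}"
      then have "x - a \<in> g -` {0}" by (simp add: g0)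
      then show "x \<in> (\<lambda>x. a + x) ` (g -` {0})" by (rule rev_image_eqI) simp
    qed (auto simp: g0)
    then show ?thesis by (simp add: card_image)
  qed
  have count: "card (g -` A) = card A * card (g -` {0})" for A
  proof -
    have "card (g -` A) = card (\<Union>y\<in>A. g -` {y})"
      by (rule arg_cong[of _ _ card]) auto
    also have "\<dots> = (\<Sum>y\<in>A. card (g -` {y}))"
      by (rule card_UN_disjoint) auto
    also have "\<dots> = (\<Sum>y\<in>A. card (g -` {0}))"
      by (rule sum.cong[OF refl fibre])
    finally show ?thesis by simp
  qed
  show ?thesis using count[of B] count[of UNIV] by simp
qed

lemma card_dot_nonzero:
  fixes v :: "'a::{field,finite} ^ 'n"
  assumes "v \<noteq> 0"
  shows "card {x. dot v x \<noteq> 0} * CARD('a) = (CARD('a) - 1) * CARD('a) ^ CARD('n)"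
proof -
  obtain a where "dot v a = 1" using exists_dot_eq_one[OF assms] by blast
  then have "dot v (s *s a) = s" for s by (simp add: dot_scale_right)
  then have "surj (dot v)" by (rule surjI[where f = "\<lambda>s. s *s a"])
  from card_vimage_additive_surj[OF dot_add_right this, of "- {0}"]
  show ?thesis by (simp add: vimage_def Compl_eq_Diff_UNIV card_Diff_subset)
qed

text \<open>For \<open>v' \<noteq> 0\<close> the two forms are independent, so they map onto all
  pairs of scalars and equality holds. For \<open>v' = 0\<close> the count is larger by a factor
  \<open>CARD('a)\<close>. The factor \<open>CARD('a)\<^sup>2\<close> on the right avoids the
  exponent n - 2.\<close>

lemma card_orthogonal_to_one_only:
  fixes v v' :: "'a::{field,finite} ^ 'n"
  assumes indep: "\<And>l. v \<noteq> l *s v'"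
  shows "(CARD('a) - 1) * CARD('a) ^ CARD('n)
           \<le> card {x. dot v' x = 0 \<and> dot v x \<noteq> 0} * CARD('a)\<^sup>2"
proof (cases "v' = 0")
  case True
  then have "v \<noteq> 0" using indep[of 0] by auto
  from card_dot_nonzero[OF this] True show ?thesis
    by (simp add: power2_eq_square mult.assoc[symmetric])
next
  case False
  obtain a where a: "dot v' a = 0" "dot v a = 1"
    using exists_orthogonal_to_one_only[OF indep] by blast
  have "v' \<noteq> l *s v" for l
  proof
    assume l: "v' = l *s v"
    then have "l \<noteq> 0" using False by auto
    then have "v = inverse l *s v'" by (simp add: l)
    then show False using indep by blast
  qed
  then obtain b where b: "dot v b = 0" "dot v' b = 1"
    using exists_orthogonal_to_one_only by blast
  define g where "g x = (dot v' x, dot v x)" for x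
  \<comment> \<open>The vectors \<open>b\<close> and \<open>a\<close> are dual to the forms of
    \<open>v'\<close> and \<open>v\<close>, which gives an explicit preimage.\<close>
  have "g (fst p *s b + snd p *s a) = p" for p
    by (simp add: g_def a b dot_add_right dot_scale_right)
  then have "surj g" by (rule surjI[where f = "\<lambda>p. fst p *s b + snd p *s a"])
  moreover have "g (x + y) = g x + g y" for x y by (simp add: g_def dot_add_right)
  ultimately have "card (g -` ({0} \<times> - {0})) * CARD('a \<times> 'a) = card ({0::'a} \<times> - {0::'a}) * CARD('a ^ 'n)"
    by (intro card_vimage_additive_surj)
  moreover have "g -` ({0} \<times> - {0}) = {x. dot v' x = 0 \<and> dot v x \<noteq> 0}"
    by (auto simp: g_def)
  ultimately show ?thesis
    by (simp add: card_cartesian_product Compl_eq_Diff_UNIV card_Diff_subset power2_eq_square)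
qed

section \<open>Codewords, supports and weights\<close>

lemma codeword_scale: "codeword f (l * u) (l *s v) = l *s codeword f u v"
  by (simp add: codeword_def vec_eq_iff dot_scale_left algebra_simps)

lemma codeword_zero [simp]: "codeword f 0 0 = 0"
  by (simp add: codeword_def vec_eq_iff)

text \<open>Codewords depend linearly on the pair \<open>(u, v)\<close>, so the spanning set is
  already a subspace.\<close>

lemma code_of_eq: "code_of f = {codeword f u v | u v. True}"
proof -
  have "vec.subspace {codeword f u v | u v. True}"
    unfolding vec.subspace_def
  proof (intro conjI ballI allI)
    have "0 = codeword f 0 0" by simp
    then show "0 \<in> {codeword f u v | u v. True}" by blast
  next
    fix x y assume "x \<in> {codeword f u v | u v. True}" "y \<in> {codeword f u v | u v. True}"
    then obtain u v u' v' where "x = codeword f u v" "y = codeword f u' v'" by blast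
    then have "x + y = codeword f (u + u') (v + v')"
      by (simp add: codeword_def vec_eq_iff dot_add_left algebra_simps)
    then show "x + y \<in> {codeword f u v | u v. True}" by blast
  next
    fix l x assume "x \<in> {codeword f u v | u v. True}"
    then obtain u v where "x = codeword f u v" by blast
    then have "l *s x = codeword f (l * u) (l *s v)"
      by (simp add: codeword_scale)
    then show "l *s x \<in> {codeword f u v | u v. True}" by blast
  qed
  then show ?thesis unfolding code_of_def by (rule vec.span_eq_iff[THEN iffD2])
qed

text \<open>Moves supports from the coordinate type to sets of vectors, where they can be compared
  and counted.\<close>

lemma vec_of_image_supp_codeword:
  "vec_of ` supp (codeword f u v) = {x. x \<noteq> 0 \<and> u * f x + dot v x \<noteq> 0}"
proof (intro equalityI subsetI)
  fix x assume x: "x \<in> {x. x \<noteq> 0 \<and> u * f x + dot v x \<noteq> 0}"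
  then have "vec_of (Abs_nonzero_vec x) = x" by (simp add: Abs_nonzero_vec_inverse)
  then show "x \<in> vec_of ` supp (codeword f u v)"
    using x by (intro image_eqI[of _ _ "Abs_nonzero_vec x"]) (auto simp: supp_def codeword_def)
qed (use vec_of in \<open>auto simp: supp_def codeword_def\<close>)

lemma hamming_weight_codeword:
  "hamming_weight (codeword f u v) = card {x. x \<noteq> 0 \<and> u * f x + dot v x \<noteq> 0}"
proof -
  have "inj_on vec_of (supp (codeword f u v))" by (simp add: inj_on_def vec_of_inject)
  from card_image[OF this] show ?thesis
    by (simp add: hamming_weight_def vec_of_image_supp_codeword)
qed

lemma hamming_weight_eq_0_iff: "hamming_weight c = 0 \<longleftrightarrow> c = 0"
  by (simp add: hamming_weight_def supp_def vec_eq_iff)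

section \<open>Minimality\<close>

lemma exists_orthogonal_to_one_only_outside:
  fixes S :: "('a::{field,finite} ^ 'n) set"
  assumes small: "card S * CARD('a)\<^sup>2 < (CARD('a) - 1) * CARD('a) ^ CARD('n)"
    and indep: "\<And>l. v \<noteq> l *s v'"
  shows "\<exists>x. x \<notin> S \<and> dot v' x = 0 \<and> dot v x \<noteq> 0"
proof (rule ccontr)
  assume "\<not> ?thesis"
  then have "{x. dot v' x = 0 \<and> dot v x \<noteq> 0} \<subseteq> S" by blast
  then have "card {x. dot v' x = 0 \<and> dot v x \<noteq> 0} \<le> card S" by (intro card_mono) auto
  then have "card {x. dot v' x = 0 \<and> dot v x \<noteq> 0} * CARD('a)\<^sup>2 \<le> card S * CARD('a)\<^sup>2"
    by (rule mult_right_mono) simp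
  then show False using card_orthogonal_to_one_only[OF indep] small by linarith
qed

lemma minimal_code_indicator:
  fixes S :: "('a::{field,finite} ^ 'n) set"
  assumes zero: "0 \<notin> S"
    and meets: "\<And>v s. v \<noteq> 0 \<Longrightarrow> \<exists>x\<in>S. dot v x = s"
    and small: "card S * CARD('a)\<^sup>2 < (CARD('a) - 1) * CARD('a) ^ CARD('n)"
  shows "minimal_code (code_of (indicator S :: _ \<Rightarrow> 'a))"
  unfolding minimal_code_def
proof (intro ballI impI)
  let ?f = "indicator S :: 'a ^ 'n \<Rightarrow> 'a"
  fix c c' assume "c \<in> code_of ?f" "c' \<in> code_of ?f" and nz: "c \<noteq> 0" and supp: "supp c \<subseteq> supp c'"
  then obtain u v u' v' where c: "c = codeword ?f u v" and c': "c' = codeword ?f u' v'"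
    unfolding code_of_eq by blast
  have van: "u * ?f x + dot v x = 0" if "x \<noteq> 0" "u' * ?f x + dot v' x = 0" for x
  proof -
    have "vec_of ` supp c \<subseteq> vec_of ` supp c'" using supp by blast
    then show ?thesis using that unfolding c c' vec_of_image_supp_codeword by blast
  qed
  have "\<exists>l. v = l *s v'"
  proof (rule ccontr)
    assume "\<not> ?thesis"
    then obtain x where x: "x \<notin> S" "dot v' x = 0" "dot v x \<noteq> 0"
      using exists_orthogonal_to_one_only_outside[OF small] by blast
    then have "x \<noteq> 0" by auto
    then show False using van[of x] x by simp
  qed
  then obtain l where l: "v = l *s v'" ..
  have "\<exists>l. u = l * u' \<and> v = l *s v'"
  proof (cases "v' = 0")
    case True
    have "u' \<noteq> 0 \<or> u = 0"
    proof (rule ccontr)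
      assume "\<not> ?thesis"
      moreover obtain x where "x \<in> S" using meets[of "axis undefined 1" 0] by (auto simp: axis_eq_0_iff)
      moreover have "x \<noteq> 0" using \<open>x \<in> S\<close> zero by auto
      ultimately show False using van[of x] True l by simp
    qed
    \<comment> \<open>If \<open>u' = 0\<close>, then \<open>u = 0\<close> as well and both sides
      vanish.\<close>
    then have "u = (u / u') * u'" by auto
    then show ?thesis using l True by (metis vec.scale_zero_right)
  next
    case False
    \<comment> \<open>The level \<open>- u'\<close> makes \<open>c'\<close> vanish at
      \<open>x\<close>, hence also \<open>c\<close>; this reads
      \<open>u - l * u' = 0\<close>.\<close>
    then obtain x where x: "x \<in> S" "dot v' x = - u'" using meets by blast
    then have "x \<noteq> 0" using zero by auto
    then have "u = l * u'" using van[of x] x by (simp add: l dot_scale_left)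
    then show ?thesis using l by blast
  qed
  then obtain m where "u = m * u'" "v = m *s v'" by blast
  then have "c = m *s c'" by (simp add: c c' codeword_scale)
  moreover from this have "m \<noteq> 0" using nz by auto
  ultimately show "\<exists>l. l \<noteq> 0 \<and> c = l *s c'" by blast
qed

section \<open>Failure of the Ashikhmin-Barg condition\<close>

text \<open>The two weights show that the ratio of maximum to minimum is at least q, and q is at
  least q/(q - 1) because q is at least 2.\<close>

lemma not_ashikhmin_barg_indicator:
  fixes S :: "('a::{field,finite} ^ 'n) set"
  assumes "0 \<notin> S" and "S \<noteq> {}"
    and small: "card S * CARD('a)\<^sup>2 < (CARD('a) - 1) * CARD('a) ^ CARD('n)"
  shows "\<not> ashikhmin_barg (code_of (indicator S :: _ \<Rightarrow> 'a))"
proof -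
  let ?f = "indicator S :: 'a ^ 'n \<Rightarrow> 'a"
  let ?C = "code_of ?f" and ?q = "CARD('a)"
  have q: "?q \<ge> 2"
    using card_mono[of UNIV "{0, 1 :: 'a}"] by simp
  \<comment> \<open>Any nonzero vector would do; \<open>undefined\<close> just names some
    coordinate.\<close>
  define v :: "'a ^ 'n" where "v = axis undefined 1"
  have "v \<noteq> 0" by (simp add: v_def axis_eq_0_iff)
  have "{x. x \<noteq> 0 \<and> dot v x \<noteq> 0} = {x. dot v x \<noteq> 0}" by auto
  then have wv: "hamming_weight (codeword ?f 0 v) * ?q = (?q - 1) * ?q ^ CARD('n)"
    using card_dot_nonzero[OF \<open>v \<noteq> 0\<close>] by (simp add: hamming_weight_codeword)
  have "{x. x \<noteq> 0 \<and> ?f x \<noteq> 0} = S" using assms(1) by (auto simp: indicator_def)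
  then have wS: "hamming_weight (codeword ?f 1 0) = card S"
    by (simp add: hamming_weight_codeword)
  have "0 < hamming_weight (codeword ?f 0 v)" using wv q by (intro gr0I) auto
  then have "codeword ?f 0 v \<in> ?C - {0}"
    by (auto simp: hamming_weight_eq_0_iff[THEN iffD2] code_of_eq)
  then have max: "hamming_weight (codeword ?f 0 v) \<le> max_weight ?C"
    unfolding max_weight_def by (intro Max_ge) auto
  have "0 < hamming_weight (codeword ?f 1 0)" using assms(2) by (simp add: wS card_gt_0_iff)
  then have S_in: "codeword ?f 1 0 \<in> ?C - {0}"
    by (auto simp: hamming_weight_eq_0_iff[THEN iffD2] code_of_eq)
  then have min: "min_weight ?C \<le> card S"
    unfolding min_weight_def wS[symmetric] by (intro Min_le) auto
  have "min_weight ?C \<in> hamming_weight ` (?C - {0})"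
    unfolding min_weight_def using S_in by (intro Min_in) auto
  \<comment> \<open>Guards the quotient of weights, since division by zero would yield 0.\<close>
  then have pos: "0 < min_weight ?C"
    by (auto simp: hamming_weight_eq_0_iff)
  have "min_weight ?C * ?q * ?q \<le> card S * ?q\<^sup>2"
    using min by (simp add: power2_eq_square)
  also have "\<dots> \<le> hamming_weight (codeword ?f 0 v) * ?q" using small wv by simp
  also have "\<dots> \<le> max_weight ?C * ?q" using max by simp
  finally have "min_weight ?C * ?q \<le> max_weight ?C" using q by simp
  then have "real (min_weight ?C) * real ?q \<le> real (max_weight ?C)"
    by (metis of_nat_le_iff of_nat_mult)
  then have "real ?q \<le> real (max_weight ?C) / real (min_weight ?C)"
    using pos by (simp add: pos_le_divide_eq mult.commute)
  moreover have "real ?q / (real ?q - 1) \<le> real ?q / 1"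
    using q by (intro divide_left_mono) auto
  ultimately show ?thesis unfolding ashikhmin_barg_def by linarith
qed

theorem theorem1:
  fixes S :: "('a::{field,finite} ^ 'n) set"
    and f :: "'a ^ 'n \<Rightarrow> 'a"
  assumes "S \<subseteq> UNIV - {0}"
    and "\<not> (\<exists>A. affine_hyperplane A \<and> S \<subseteq> A)"
    and "\<And>A. affine_hyperplane A \<Longrightarrow> S \<inter> A \<noteq> {}"
    and "real (card S) < real CARD('a) powi (int CARD('n) - 2) * (real CARD('a) - 1)"
    and "f = indicator S"
  shows "minimal_code (code_of f) \<and> \<not> ashikhmin_barg (code_of f)"
proof -
  have zero: "0 \<notin> S" using assms(1) by blast
  have meets: "\<exists>x\<in>S. dot v x = s" if "v \<noteq> 0" for v s
    using assms(3)[OF affine_hyperplane_dot_eq[OF that, of s]] by blast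
  have "S \<noteq> {}" using meets[of "axis undefined 1" 0] by (auto simp: axis_eq_0_iff)
  have q: "CARD('a) > 0" by simp
  \<comment> \<open>The exponent is negative when n = 1, so the bound is multiplied by the square of
    q before passing to natural numbers.\<close>
  have "real CARD('a) powi (int CARD('n) - 2) = real CARD('a) ^ CARD('n) / real CARD('a) ^ 2"
    by (simp add: power_int_diff)
  with assms(4) have "real (card S) < (real CARD('a) - 1) * real CARD('a) ^ CARD('n) / real CARD('a) ^ 2"
    by (simp add: mult.commute)
  then have "real (card S) * real CARD('a) ^ 2 < (real CARD('a) - 1) * real CARD('a) ^ CARD('n)"
    by (simp add: pos_less_divide_eq)
  then have "real (card S * CARD('a)\<^sup>2) < real ((CARD('a) - 1) * CARD('a) ^ CARD('n))"
    using q by (simp add: of_nat_diff Suc_leI)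
  then have small: "card S * CARD('a)\<^sup>2 < (CARD('a) - 1) * CARD('a) ^ CARD('n)"
    by (simp only: of_nat_less_iff)
  show ?thesis
    unfolding assms(5)
    using minimal_code_indicator[OF zero meets small]
      not_ashikhmin_barg_indicator[OF zero \<open>S \<noteq> {}\<close> small] by blast
qed

end
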